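(* Let $L$ be a lattice. If $V$ and $W$ are nonempty subsets of $L$ such that $\bigcap_{x\in V}\epsilon_L(x)\subseteq\bigcup_{y\in W}\delta_L(y)$, then there exist finite nonempty subsets $V_1\subseteq V$ and $W_1\subseteq W$ such that $\bigcap_{x\in V_1}\epsilon_L(x)\subseteq\bigcup_{y\in W_1}\delta_L(y)$.
   Context: Ideals and filters of a lattice are nonempty. A comaximal pair of $L$ is a pair $(I,F)$, $I$ an ideal and $F$ a filter, with $I\cap F=\emptyset$, such that every ideal $J\supsetneq I$ meets $F$ and every filter $K\supsetneq F$ meets $I$. $\mathfrak{M}(L)$ is the set of comaximal pairs, $\delta_L(x)=\{(I,F)\in\mathfrak{M}(L):x\notin I\}$ and $\epsilon_L(x)=\{(I,F)\in\mathfrak{M}(L):x\in F\}$. *)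

theory Defs
  imports Main
begin

definition lattice_ideal :: "'a::lattice set \<Rightarrow> bool" where
  "lattice_ideal I \<longleftrightarrow>
     I \<noteq> {} \<and> (\<forall>x y. x \<le> y \<longrightarrow> y \<in> I \<longrightarrow> x \<in> I) \<and> (\<forall>x\<in>I. \<forall>y\<in>I. sup x y \<in> I)"

definition lattice_filter :: "'a::lattice set \<Rightarrow> bool" where
  "lattice_filter F \<longleftrightarrow>
     F \<noteq> {} \<and> (\<forall>x y. x \<le> y \<longrightarrow> x \<in> F \<longrightarrow> y \<in> F) \<and> (\<forall>x\<in>F. \<forall>y\<in>F. inf x y \<in> F)"

definition comaximal_pairs :: "('a::lattice set \<times> 'a set) set" where
  "comaximal_pairs = {(I, F). lattice_ideal I \<and> lattice_filter F \<and> I \<inter> F = {} \<and>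
     (\<forall>J. lattice_ideal J \<longrightarrow> I \<subset> J \<longrightarrow> J \<inter> F \<noteq> {}) \<and>
     (\<forall>K. lattice_filter K \<longrightarrow> F \<subset> K \<longrightarrow> K \<inter> I \<noteq> {})}"

definition delta :: "'a::lattice \<Rightarrow> ('a set \<times> 'a set) set" where
  "delta x = {(I, F) \<in> comaximal_pairs. x \<notin> I}"

definition epsilon :: "'a::lattice \<Rightarrow> ('a set \<times> 'a set) set" where
  "epsilon x = {(I, F) \<in> comaximal_pairs. x \<in> F}"

end

(* If no finite meet of elements of V lies below a finite join of elements of W, then the filter
   generated by V is disjoint from the ideal generated by W, and enlarging first the ideal and
   then the filter (Zorn) gives a comaximal pair in every epsilon x (x in V) and no delta y (y in W).
   So some finite meet of V lies below a finite join of W, and these finite sets work. *)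
theory Submission
  imports Defs
begin

text \<open>This supplies the chain condition for Zorn's lemma. Closure under \<open>sup\<close> is
  where linearity enters: two elements from different members of the chain already lie together in
  the larger one, so their join never leaves that member.\<close>

lemma lattice_ideal_Union_chain:
  assumes "\<C> \<noteq> {}" and "\<And>I. I \<in> \<C> \<Longrightarrow> lattice_ideal I"
    and "\<And>I J. I \<in> \<C> \<Longrightarrow> J \<in> \<C> \<Longrightarrow> I \<subseteq> J \<or> J \<subseteq> I"
  shows "lattice_ideal (\<Union>\<C>)"
  unfolding lattice_ideal_def
proof (intro conjI ballI allI impI)
  obtain I where "I \<in> \<C>" using assms(1) by blast
  then have "I \<noteq> {}" using assms(2) unfolding lattice_ideal_def by blast
  then show "\<Union>\<C> \<noteq> {}" using \<open>I \<in> \<C>\<close> by blast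
next
  fix x y assume "x \<le> y" "y \<in> \<Union>\<C>"
  then obtain I where "I \<in> \<C>" "y \<in> I" by blast
  then have "x \<in> I"
    using assms(2)[of I] \<open>x \<le> y\<close> unfolding lattice_ideal_def by blast
  then show "x \<in> \<Union>\<C>" using \<open>I \<in> \<C>\<close> by blast
next
  fix x y assume "x \<in> \<Union>\<C>" "y \<in> \<Union>\<C>"
  then obtain I J where "I \<in> \<C>" "x \<in> I" "J \<in> \<C>" "y \<in> J" by blast
  then obtain K where "K \<in> \<C>" "x \<in> K" "y \<in> K"
    using assms(3)[of I J] by blast
  moreover from this have "sup x y \<in> K"
    using assms(2)[of K] unfolding lattice_ideal_def by simp
  ultimately show "sup x y \<in> \<Union>\<C>" by blast
qed

lemma lattice_filter_Union_chain:
  assumes "\<C> \<noteq> {}" and "\<And>F. F \<in> \<C> \<Longrightarrow> lattice_filter F"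
    and "\<And>F G. F \<in> \<C> \<Longrightarrow> G \<in> \<C> \<Longrightarrow> F \<subseteq> G \<or> G \<subseteq> F"
  shows "lattice_filter (\<Union>\<C>)"
  unfolding lattice_filter_def
proof (intro conjI ballI allI impI)
  obtain F where "F \<in> \<C>" using assms(1) by blast
  then have "F \<noteq> {}" using assms(2) unfolding lattice_filter_def by blast
  then show "\<Union>\<C> \<noteq> {}" using \<open>F \<in> \<C>\<close> by blast
next
  fix x y assume "x \<le> y" "x \<in> \<Union>\<C>"
  then obtain F where "F \<in> \<C>" "x \<in> F" by blast
  then have "y \<in> F"
    using assms(2)[of F] \<open>x \<le> y\<close> unfolding lattice_filter_def by blast
  then show "y \<in> \<Union>\<C>" using \<open>F \<in> \<C>\<close> by blast
next
  fix x y assume "x \<in> \<Union>\<C>" "y \<in> \<Union>\<C>"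
  then obtain F G where "F \<in> \<C>" "x \<in> F" "G \<in> \<C>" "y \<in> G" by blast
  then obtain K where "K \<in> \<C>" "x \<in> K" "y \<in> K"
    using assms(3)[of F G] by blast
  moreover from this have "inf x y \<in> K"
    using assms(2)[of K] unfolding lattice_filter_def by simp
  ultimately show "inf x y \<in> \<Union>\<C>" by blast
qed

text \<open>The predicate \<open>P\<close> is kept abstract so that one Zorn argument serves ideals
  and filters alike. Zorn is applied to the \<open>P\<close>-sets that contain \<open>A0\<close> and
  avoid \<open>D\<close>. A set strictly above a maximal member \<open>M\<close> contains
  \<open>A0\<close> automatically, so if it satisfies \<open>P\<close> it can only fail by meeting
  \<open>D\<close>; this is the form of maximality used in \<open>comaximal_pairs\<close>.\<close>

lemma maximal_disjoint_extension:
  assumes chain: "\<And>\<C>. \<C> \<noteq> {} \<Longrightarrow> (\<And>A. A \<in> \<C> \<Longrightarrow> P A) \<Longrightarrow>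
      (\<And>A B. A \<in> \<C> \<Longrightarrow> B \<in> \<C> \<Longrightarrow> A \<subseteq> B \<or> B \<subseteq> A) \<Longrightarrow> P (\<Union>\<C>)"
    and "P A0" and "A0 \<inter> D = {}"
  shows "\<exists>M. P M \<and> A0 \<subseteq> M \<and> M \<inter> D = {} \<and> (\<forall>X. P X \<longrightarrow> M \<subset> X \<longrightarrow> X \<inter> D \<noteq> {})"
proof -
  let ?S = "{A. P A \<and> A0 \<subseteq> A \<and> A \<inter> D = {}}"
  have "\<exists>M\<in>?S. \<forall>X\<in>?S. M \<subseteq> X \<longrightarrow> X = M"
  proof (rule subset_Zorn_nonempty)
    show "?S \<noteq> {}" using assms(2,3) by blast
    fix \<C> assume ne: "\<C> \<noteq> {}" and "subset.chain ?S \<C>"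
    then have sub: "\<C> \<subseteq> ?S"
      and lin: "\<And>A B. A \<in> \<C> \<Longrightarrow> B \<in> \<C> \<Longrightarrow> A \<subseteq> B \<or> B \<subseteq> A"
      by (auto simp: subset_chain_def)
    have "P (\<Union>\<C>)"
      using ne sub lin by (intro chain) auto
    moreover have "A0 \<subseteq> \<Union>\<C>" using ne sub by blast
    moreover have "\<Union>\<C> \<inter> D = {}" using sub by blast
    ultimately show "\<Union>\<C> \<in> ?S" by blast
  qed
  then obtain M where M: "M \<in> ?S" and max: "\<forall>X\<in>?S. M \<subseteq> X \<longrightarrow> X = M" by blast
  have "X \<inter> D \<noteq> {}" if "P X" "M \<subset> X" for X
  proof
    assume "X \<inter> D = {}"
    then have "X \<in> ?S" using that M by blast
    then show False using max that(2) by blast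
  qed
  then show ?thesis using M by blast
qed

text \<open>The two enlargements are done in sequence: \<open>I\<close> is maximal among the ideals
  above \<open>I0\<close> that avoid \<open>F0\<close>, and only then is \<open>F\<close> chosen
  maximal among the filters above \<open>F0\<close> that avoid this fixed \<open>I\<close>.\<close>

lemma comaximal_pair_extension:
  assumes "lattice_ideal I0" and "lattice_filter F0" and "I0 \<inter> F0 = {}"
  obtains I F where "(I, F) \<in> comaximal_pairs" and "I0 \<subseteq> I" and "F0 \<subseteq> F"
proof -
  have "\<exists>I. lattice_ideal I \<and> I0 \<subseteq> I \<and> I \<inter> F0 = {} \<and>
      (\<forall>J. lattice_ideal J \<longrightarrow> I \<subset> J \<longrightarrow> J \<inter> F0 \<noteq> {})"
    by (rule maximal_disjoint_extension[OF lattice_ideal_Union_chain assms(1,3)])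
  then obtain I where I: "lattice_ideal I" "I0 \<subseteq> I" "I \<inter> F0 = {}"
    "\<And>J. lattice_ideal J \<Longrightarrow> I \<subset> J \<Longrightarrow> J \<inter> F0 \<noteq> {}"
    by blast
  have "F0 \<inter> I = {}" using I(3) by blast
  have "\<exists>F. lattice_filter F \<and> F0 \<subseteq> F \<and> F \<inter> I = {} \<and>
      (\<forall>K. lattice_filter K \<longrightarrow> F \<subset> K \<longrightarrow> K \<inter> I \<noteq> {})"
    by (rule maximal_disjoint_extension[OF lattice_filter_Union_chain assms(2) \<open>F0 \<inter> I = {}\<close>])
  then obtain F where F: "lattice_filter F" "F0 \<subseteq> F" "F \<inter> I = {}"
    "\<And>K. lattice_filter K \<Longrightarrow> F \<subset> K \<Longrightarrow> K \<inter> I \<noteq> {}"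
    by blast
  \<comment> \<open>The second enlargement does not spoil the maximality of \<open>I\<close>: a
    larger ideal already meets \<open>F0\<close>, hence also the bigger filter
    \<open>F\<close>.\<close>
  have "J \<inter> F \<noteq> {}" if "lattice_ideal J" "I \<subset> J" for J
    using I(4)[OF that] F(2) by blast
  then have "(I, F) \<in> comaximal_pairs"
    using I(1) F unfolding comaximal_pairs_def by blast
  then show thesis using that I(2) F(2) by blast
qed

lemma lattice_ideal_Sup_fin:
  assumes "lattice_ideal I" and "finite A" and "A \<noteq> {}" and "A \<subseteq> I"
  shows "Sup_fin A \<in> I"
  using assms(2-4)
proof (induction rule: finite_ne_induct)
  case (insert x A)
  then show ?case
    using assms(1) by (simp add: lattice_ideal_def)
qed simp

lemma lattice_filter_Inf_fin:
  assumes "lattice_filter F" and "finite A" and "A \<noteq> {}" and "A \<subseteq> F"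
  shows "Inf_fin A \<in> F"
  using assms(2-4)
proof (induction rule: finite_ne_induct)
  case (insert x A)
  then show ?case
    using assms(1) by (simp add: lattice_filter_def)
qed simp

text \<open>Describing the generated ideal by finite joins, rather than as an intersection of
  ideals, lets membership hand over the finite subset sought in the theorem. The sets
  \<open>A\<close> are nonempty because the lattice need not have a least element to serve as an
  empty join.\<close>

definition generated_ideal :: "'a::lattice set \<Rightarrow> 'a set" where
  "generated_ideal W = {z. \<exists>A. finite A \<and> A \<noteq> {} \<and> A \<subseteq> W \<and> z \<le> Sup_fin A}"

definition generated_filter :: "'a::lattice set \<Rightarrow> 'a set" where
  "generated_filter V = {z. \<exists>A. finite A \<and> A \<noteq> {} \<and> A \<subseteq> V \<and> Inf_fin A \<le> z}"

lemma subset_generated_ideal: "W \<subseteq> generated_ideal W"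
proof
  fix x assume "x \<in> W"
  then show "x \<in> generated_ideal W"
    unfolding generated_ideal_def by (intro CollectI exI[of _ "{x}"]) simp
qed

lemma subset_generated_filter: "V \<subseteq> generated_filter V"
proof
  fix x assume "x \<in> V"
  then show "x \<in> generated_filter V"
    unfolding generated_filter_def by (intro CollectI exI[of _ "{x}"]) simp
qed

lemma lattice_ideal_generated_ideal:
  assumes "W \<noteq> {}"
  shows "lattice_ideal (generated_ideal W)"
  unfolding lattice_ideal_def
proof (intro conjI ballI allI impI)
  show "generated_ideal W \<noteq> {}" using assms subset_generated_ideal by blast
next
  fix x y assume "x \<le> y" "y \<in> generated_ideal W"
  then show "x \<in> generated_ideal W"
    unfolding generated_ideal_def by (blast intro: order_trans)
next
  fix x y assume "x \<in> generated_ideal W" "y \<in> generated_ideal W"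
  then obtain A B where A: "finite A" "A \<noteq> {}" "A \<subseteq> W" "x \<le> Sup_fin A"
    and B: "finite B" "B \<noteq> {}" "B \<subseteq> W" "y \<le> Sup_fin B"
    unfolding generated_ideal_def by blast
  \<comment> \<open>The union of the two finite sets is the witness for the join, since its supremum
    is the join of the two suprema.\<close>
  then have "sup x y \<le> Sup_fin (A \<union> B)"
    by (simp add: Sup_fin.union sup_mono del: sup.bounded_iff)
  then show "sup x y \<in> generated_ideal W"
    unfolding generated_ideal_def using A B by (intro CollectI exI[of _ "A \<union> B"]) simp
qed

lemma lattice_filter_generated_filter:
  assumes "V \<noteq> {}"
  shows "lattice_filter (generated_filter V)"
  unfolding lattice_filter_def
proof (intro conjI ballI allI impI)
  show "generated_filter V \<noteq> {}" using assms subset_generated_filter by blast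
next
  fix x y assume "x \<le> y" "x \<in> generated_filter V"
  then show "y \<in> generated_filter V"
    unfolding generated_filter_def by (blast intro: order_trans)
next
  fix x y assume "x \<in> generated_filter V" "y \<in> generated_filter V"
  then obtain A B where A: "finite A" "A \<noteq> {}" "A \<subseteq> V" "Inf_fin A \<le> x"
    and B: "finite B" "B \<noteq> {}" "B \<subseteq> V" "Inf_fin B \<le> y"
    unfolding generated_filter_def by blast
  then have "Inf_fin (A \<union> B) \<le> inf x y"
    by (simp add: Inf_fin.union inf_mono del: inf.bounded_iff)
  then show "inf x y \<in> generated_filter V"
    unfolding generated_filter_def using A B by (intro CollectI exI[of _ "A \<union> B"]) simp
qed

theorem mainTheorem6:
  fixes V W :: "'a::lattice set"
  assumes "V \<noteq> {}" and "W \<noteq> {}"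
    and "(\<Inter>x\<in>V. epsilon x) \<subseteq> (\<Union>y\<in>W. delta y)"
  shows "\<exists>V1 W1. finite V1 \<and> V1 \<noteq> {} \<and> V1 \<subseteq> V \<and>
           finite W1 \<and> W1 \<noteq> {} \<and> W1 \<subseteq> W \<and>
           (\<Inter>x\<in>V1. epsilon x) \<subseteq> (\<Union>y\<in>W1. delta y)"
proof -
  have "generated_ideal W \<inter> generated_filter V \<noteq> {}"
  proof
    assume "generated_ideal W \<inter> generated_filter V = {}"
    then obtain I F where IF: "(I, F) \<in> comaximal_pairs"
      "generated_ideal W \<subseteq> I" "generated_filter V \<subseteq> F"
      using comaximal_pair_extension[OF lattice_ideal_generated_ideal[OF assms(2)]
          lattice_filter_generated_filter[OF assms(1)]] by blast
    have "(I, F) \<in> (\<Inter>x\<in>V. epsilon x)"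
      using IF subset_generated_filter[of V] unfolding epsilon_def by blast
    moreover have "(I, F) \<notin> (\<Union>y\<in>W. delta y)"
      using IF subset_generated_ideal[of W] unfolding delta_def by blast
    ultimately show False using assms(3) by blast
  qed
  then obtain z where "z \<in> generated_ideal W" "z \<in> generated_filter V" by blast
  \<comment> \<open>The common element \<open>z\<close> is interpolated between a finite meet from
    \<open>V\<close> and a finite join from \<open>W\<close>; the sets that witness its two
    memberships are the required ones.\<close>
  then obtain V1 W1 where V1: "finite V1" "V1 \<noteq> {}" "V1 \<subseteq> V" "Inf_fin V1 \<le> z"
    and W1: "finite W1" "W1 \<noteq> {}" "W1 \<subseteq> W" "z \<le> Sup_fin W1"
    unfolding generated_ideal_def generated_filter_def by blast
  have "(\<Inter>x\<in>V1. epsilon x) \<subseteq> (\<Union>y\<in>W1. delta y)"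
  proof
    fix p assume p: "p \<in> (\<Inter>x\<in>V1. epsilon x)"
    obtain I F where [simp]: "p = (I, F)" by (cases p)
    \<comment> \<open>Nonemptiness of \<open>V1\<close> matters here: an intersection over the empty
      set would be everything, and \<open>p\<close> would not have to be a comaximal pair.\<close>
    have cm: "(I, F) \<in> comaximal_pairs" and "V1 \<subseteq> F"
      using p V1(2) unfolding epsilon_def by auto
    then have I: "lattice_ideal I" and F: "lattice_filter F" and disj: "I \<inter> F = {}"
      unfolding comaximal_pairs_def by auto
    have "Inf_fin V1 \<in> F"
      using lattice_filter_Inf_fin[OF F V1(1,2) \<open>V1 \<subseteq> F\<close>] .
    moreover have "Inf_fin V1 \<le> Sup_fin W1" using V1(4) W1(4) by (rule order_trans)
    ultimately have "Sup_fin W1 \<in> F" using F unfolding lattice_filter_def by blast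
    \<comment> \<open>If all of \<open>W1\<close> lay in \<open>I\<close>, its join would lie in
      both \<open>I\<close> and \<open>F\<close>. So some \<open>y\<close> in \<open>W1\<close> is
      outside \<open>I\<close>, which puts \<open>p\<close> in \<open>delta y\<close>.\<close>
    then have "\<not> W1 \<subseteq> I" using lattice_ideal_Sup_fin[OF I W1(1,2)] disj by blast
    then show "p \<in> (\<Union>y\<in>W1. delta y)"
      using cm unfolding delta_def by auto
  qed
  then show ?thesis using V1 W1 by blast
qed

end
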